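(* (Combinatory completeness.) Let $(A,P)$ be a ppca and let $e$ be an expression over $(A,P)$ in variables $x_1,\dots,x_n,x_{n+1}$. Then there is $e^*\in A$ such that, for all $a_1,\dots,a_{n+1}\in A$: 1. the closed expression $e^*\,a_1\cdots a_n$ is uniform; and 2. for all $p\in P$, $(p\mid e^*\,a_1\cdots a_{n+1})\simeq(p\mid e[a_1/x_1,\dots,a_{n+1}/x_{n+1}])$.
   Context: A ppca $(A,P)$ is a set $A$, a nonempty set $P$, and a partial application $P\times A\times A\rightharpoonup A$, written $a\cdot_pb$. There must be $k,s\in A$ such that, for all $p,q\in P$ and $a,b,c\in A$: - $k\cdot_pa=k\cdot_qa$ (both defined); - $(k\cdot_pa)\cdot_pb=a$; - $s\cdot_pa=s\cdot_qa$ (both defined); - $(s\cdot_pa)\cdot_pb=(s\cdot_qa)\cdot_qb$ (both defined); - $((s\cdot_pa)\cdot_pb)\cdot_pc\simeq(a\cdot_pc)\cdot_p(b\cdot_pc)$, where $\simeq$ means one side is defined iff the other is, and then they are equal. Expressions in variables $x_1,\dots,x_m$ are built from the variables and constants $a\in A$ by formal binary application. Application is written as juxtaposition and associates to the left. An expression is closed if it contains no variables, and $e[a_1/x_1,\dots]$ denotes substitution. For $p\in P$ and a closed expression $e$, the possibly undefined value $p\mid e$ is defined recursively by $p\mid a=a$ and $p\mid(e_1e_2)=(p\mid e_1)\cdot_p(p\mid e_2)$. A closed expression $e$ is uniform if $p\mid e$ is defined and $p\mid e=q\mid e$ for all $p,q\in P$. *)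

theory Defs
  imports Main
begin

text \<open>
  Possibly undefined values of \<open>A\<close> are rendered in \<open>'a option\<close>, with \<open>None\<close> for ``undefined''.
  Kleene equality is then equality of options. A partial application is a function
  \<open>app\<close> with \<open>app p a b\<close> standing for the application of \<open>a\<close> to \<open>b\<close> at \<open>p\<close>; only its values
  at \<open>p \<in> P\<close> and \<open>a, b \<in> A\<close> are relevant.
\<close>

text \<open>Strict extension of the application to possibly undefined arguments.\<close>

definition lift_app ::
  "('p \<Rightarrow> 'a \<Rightarrow> 'a \<Rightarrow> 'a option) \<Rightarrow> 'p \<Rightarrow> 'a option \<Rightarrow> 'a option \<Rightarrow> 'a option"
  where "lift_app app p u v = Option.bind u (\<lambda>a. Option.bind v (\<lambda>b. app p a b))"

locale ppca =
  fixes A :: "'a set" and P :: "'p set"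
    and app :: "'p \<Rightarrow> 'a \<Rightarrow> 'a \<Rightarrow> 'a option"
  assumes P_nonempty: "P \<noteq> {}"
    and app_closed: "\<lbrakk>p \<in> P; a \<in> A; b \<in> A; app p a b = Some c\<rbrakk> \<Longrightarrow> c \<in> A"
    and combinators: "\<exists>k\<in>A. \<exists>s\<in>A. \<forall>p\<in>P. \<forall>q\<in>P. \<forall>a\<in>A. \<forall>b\<in>A. \<forall>c\<in>A.
      app p k a \<noteq> None \<and> app q k a \<noteq> None \<and> app p k a = app q k a \<and>
      lift_app app p (app p k a) (Some b) = Some a \<and>
      app p s a \<noteq> None \<and> app q s a \<noteq> None \<and> app p s a = app q s a \<and>
      lift_app app p (app p s a) (Some b) \<noteq> None \<and>
      lift_app app q (app q s a) (Some b) \<noteq> None \<and>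
      lift_app app p (app p s a) (Some b) = lift_app app q (app q s a) (Some b) \<and>
      lift_app app p (lift_app app p (app p s a) (Some b)) (Some c)
        = lift_app app p (app p a c) (app p b c)"

text \<open>\<open>Var i\<close> is the variable \<open>x\<^sub>i\<close>, with indices starting at 1.\<close>

datatype 'a expr = Var nat | Const 'a | App "'a expr" "'a expr"

primrec vars :: "'a expr \<Rightarrow> nat set" where
  "vars (Var i) = {i}"
| "vars (Const a) = {}"
| "vars (App e1 e2) = vars e1 \<union> vars e2"

primrec consts_of :: "'a expr \<Rightarrow> 'a set" where
  "consts_of (Var i) = {}"
| "consts_of (Const a) = {a}"
| "consts_of (App e1 e2) = consts_of e1 \<union> consts_of e2"

text \<open>Expressions with constants in \<open>A\<close> and variables among \<open>x\<^sub>1, \<dots>, x\<^sub>m\<close>.\<close>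

definition expr_over :: "'a set \<Rightarrow> nat \<Rightarrow> 'a expr \<Rightarrow> bool"
  where "expr_over A m e \<longleftrightarrow> vars e \<subseteq> {1..m} \<and> consts_of e \<subseteq> A"

definition closed_expr :: "'a set \<Rightarrow> 'a expr \<Rightarrow> bool"
  where "closed_expr A e \<longleftrightarrow> vars e = {} \<and> consts_of e \<subseteq> A"

text \<open>Left-associated iterated application \<open>e e\<^sub>1 \<dots> e\<^sub>m\<close>.\<close>

definition App_list :: "'a expr \<Rightarrow> 'a expr list \<Rightarrow> 'a expr"
  where "App_list e es = foldl App e es"

text \<open>The simultaneous substitution \<open>e[a 1/x\<^sub>1, \<dots>, a m/x\<^sub>m]\<close>.\<close>

primrec subst_expr :: "nat \<Rightarrow> (nat \<Rightarrow> 'a) \<Rightarrow> 'a expr \<Rightarrow> 'a expr" where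
  "subst_expr m a (Var i) = (if i \<in> {1..m} then Const (a i) else Var i)"
| "subst_expr m a (Const c) = Const c"
| "subst_expr m a (App e1 e2) = App (subst_expr m a e1) (subst_expr m a e2)"

text \<open>
  The value \<open>p | e\<close>. It is meant for closed expressions; the equation for variables is only
  there to make the function total.
\<close>

primrec eval_expr :: "('p \<Rightarrow> 'a \<Rightarrow> 'a \<Rightarrow> 'a option) \<Rightarrow> 'p \<Rightarrow> 'a expr \<Rightarrow> 'a option" where
  "eval_expr app p (Var i) = None"
| "eval_expr app p (Const a) = Some a"
| "eval_expr app p (App e1 e2) = lift_app app p (eval_expr app p e1) (eval_expr app p e2)"

definition uniform_expr ::
  "'a set \<Rightarrow> 'p set \<Rightarrow> ('p \<Rightarrow> 'a \<Rightarrow> 'a \<Rightarrow> 'a option) \<Rightarrow> 'a expr \<Rightarrow> bool"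
  where "uniform_expr A P app e \<longleftrightarrow> closed_expr A e \<and>
    (\<forall>p\<in>P. \<forall>q\<in>P. eval_expr app p e \<noteq> None \<and> eval_expr app p e = eval_expr app q e)"

end

theory Submission
  imports Defs
begin

text \<open>
  Bracket abstraction with \<open>k\<close> applied to atoms only: \<open>[x]x = s k k\<close>, \<open>[x]y = k y\<close> and
  \<open>[x](e e') = s ([x]e) ([x]e')\<close>. Using \<open>k e\<close> for a compound \<open>e\<close> without \<open>x\<close> would fail, since
  \<open>e\<close> may be undefined or depend on \<open>p\<close>. By induction every \<open>[x]e\<close> is uniform under every
  assignment, because \<open>k a\<close> and \<open>s a b\<close> have a value that does not depend on \<open>p\<close>. Hence
  \<open>[x\<^sub>1]\<dots>[x\<^sub>n\<^sub>+\<^sub>1]e\<close> has a uniform value \<open>e\<^sup>*\<close>, each application to an argument strips one abstraction,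
  and after \<open>n\<close> arguments one is left with an instance of the uniform \<open>[x\<^sub>n\<^sub>+\<^sub>1]e\<close>.
\<close>

lemma lift_app_simps [simp]:
  "lift_app app p None v = None"
  "lift_app app p u None = None"
  "lift_app app p (Some a) (Some b) = app p a b"
  by (cases u; simp add: lift_app_def)+

primrec abstr :: "'a \<Rightarrow> 'a \<Rightarrow> nat \<Rightarrow> 'a expr \<Rightarrow> 'a expr" where
  "abstr k s x (Var y) =
    (if y = x then App (App (Const s) (Const k)) (Const k) else App (Const k) (Var y))"
| "abstr k s x (Const c) = App (Const k) (Const c)"
| "abstr k s x (App e1 e2) = App (App (Const s) (abstr k s x e1)) (abstr k s x e2)"

lemma vars_abstr [simp]: "vars (abstr k s x e) = vars e - {x}"
  by (induction e) auto

lemma vars_foldr_abstr [simp]: "vars (foldr (abstr k s) xs e) = vars e - set xs"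
  by (induction xs) auto

lemma consts_of_abstr: "consts_of (abstr k s x e) \<subseteq> {k, s} \<union> consts_of e"
  by (induction e) auto

lemma consts_of_foldr_abstr:
  "consts_of (foldr (abstr k s) xs e) \<subseteq> {k, s} \<union> consts_of e"
proof (induction xs)
  case (Cons x xs)
  then show ?case
    using consts_of_abstr [of k s x "foldr (abstr k s) xs e"] by auto
qed auto

lemma subst_expr_closed: "vars e = {} \<Longrightarrow> subst_expr m a e = e"
  by (induction e) auto

lemma App_list_snoc: "App_list e (es @ [e']) = App (App_list e es) e'"
  by (simp add: App_list_def)

lemma closed_expr_App_list:
  "closed_expr A (App_list e es) \<longleftrightarrow> closed_expr A e \<and> (\<forall>e'\<in>set es. closed_expr A e')"
  by (induction es arbitrary: e) (auto simp: App_list_def closed_expr_def)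

text \<open>Choosing \<open>c\<close> before \<open>p\<close> expresses definedness and independence
  of \<open>p\<close> at once. How \<open>c\<close> acts on a further argument may still depend on
  \<open>p\<close>.\<close>

locale uniform_combinators =
  fixes A :: "'a set" and P :: "'p set"
    and app :: "'p \<Rightarrow> 'a \<Rightarrow> 'a \<Rightarrow> 'a option"
    and k s :: 'a
  assumes k_in: "k \<in> A" and s_in: "s \<in> A"
    and k_app: "a \<in> A \<Longrightarrow> \<exists>c\<in>A. \<forall>p\<in>P. app p k a = Some c \<and> (\<forall>b\<in>A. app p c b = Some a)"
    and s_app: "\<lbrakk>a \<in> A; b \<in> A\<rbrakk> \<Longrightarrow> \<exists>c\<in>A. \<forall>p\<in>P. lift_app app p (app p s a) (Some b) = Some c \<and>
      (\<forall>d\<in>A. app p c d = lift_app app p (app p a d) (app p b d))"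
begin

text \<open>Uniformity and the beta law are proved together: in the application case the uniform
  values \<open>c1\<close>, \<open>c2\<close> of the two halves are elements of \<open>A\<close> to
  which \<open>s\<close> can be applied, while the instances of \<open>e1\<close> and
  \<open>e2\<close> themselves may be undefined.\<close>

lemma eval_abstr:
  assumes "x \<in> {1..m}" and "vars e \<subseteq> {1..m}" and "consts_of e \<subseteq> A"
    and "\<forall>i\<in>{1..m}. \<rho> i \<in> A"
  shows "\<exists>c\<in>A. \<forall>p\<in>P. eval_expr app p (subst_expr m \<rho> (abstr k s x e)) = Some c \<and>
    (\<forall>b\<in>A. app p c b = eval_expr app p (subst_expr m (\<rho>(x := b)) e))"
  using assms(2,3)
proof (induction e)
  case (Var y)
  show ?case
  proof (cases "y = x")
    case True
    obtain c where c: "c \<in> A" "\<And>p. p \<in> P \<Longrightarrow> lift_app app p (app p s k) (Some k) = Some c"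
      "\<And>p d. \<lbrakk>p \<in> P; d \<in> A\<rbrakk> \<Longrightarrow> app p c d = lift_app app p (app p k d) (app p k d)"
      using s_app [OF k_in k_in] by blast
    \<comment> \<open>Here \<open>c\<close> is the value of \<open>s k k\<close>, so
      \<open>c b\<close> equals \<open>(k b) (k b)\<close>. As \<open>k b\<close> is an element of
      \<open>A\<close>, it may serve as its own argument and returns \<open>b\<close>.\<close>
    have "app p c b = Some b" if "p \<in> P" "b \<in> A" for p b
      using k_app [OF \<open>b \<in> A\<close>] c(3) that by force
    with c assms(1) True show ?thesis by auto
  next
    case False
    with Var assms(4) k_app [of "\<rho> y"] show ?thesis by auto
  qed
next
  case (Const c)
  with k_app [of c] show ?case by auto
next
  case (App e1 e2)
  let ?v = "\<lambda>p e. eval_expr app p (subst_expr m \<rho> (abstr k s x e))"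
  let ?w = "\<lambda>p b e. eval_expr app p (subst_expr m (\<rho>(x := b)) e)"
  have sub: "vars e1 \<subseteq> {1..m}" "consts_of e1 \<subseteq> A" "vars e2 \<subseteq> {1..m}" "consts_of e2 \<subseteq> A"
    using App.prems by auto
  obtain c1 where c1: "c1 \<in> A" "\<forall>p\<in>P. ?v p e1 = Some c1 \<and> (\<forall>b\<in>A. app p c1 b = ?w p b e1)"
    using App.IH(1) [OF sub(1,2)] by blast
  obtain c2 where c2: "c2 \<in> A" "\<forall>p\<in>P. ?v p e2 = Some c2 \<and> (\<forall>b\<in>A. app p c2 b = ?w p b e2)"
    using App.IH(2) [OF sub(3,4)] by blast
  show ?case
    using s_app [OF c1(1) c2(1)] c1 c2 by (simp del: fun_upd_apply)
qed

lemma combinatory_completeness: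
  assumes "expr_over A (n + 1) e"
  shows "\<exists>estar\<in>A. \<forall>a :: nat \<Rightarrow> 'a. (\<forall>i\<in>{1..n + 1}. a i \<in> A) \<longrightarrow>
    uniform_expr A P app (App_list (Const estar) (map (\<lambda>i. Const (a i)) [1..<n + 1])) \<and>
    (\<forall>p\<in>P. eval_expr app p (App_list (Const estar) (map (\<lambda>i. Const (a i)) [1..<n + 2]))
          = eval_expr app p (subst_expr (n + 1) a e))"
proof -
  \<comment> \<open>\<open>t j\<close> has \<open>x_{j+1}, ..., x_{n+1}\<close> abstracted, so at
    most \<open>x_1, ..., x_j\<close> remain free: \<open>t 0\<close> is closed and
    \<open>t (n + 1)\<close> is \<open>e\<close>.\<close>
  define t where "t j = foldr (abstr k s) [j + 1..<n + 2] e" for j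
  have t_abs: "t j = abstr k s (j + 1) (t (j + 1))" if "j \<le> n" for j
  proof -
    have "[j + 1..<n + 2] = (j + 1) # [j + 2..<n + 2]"
      using that by (subst upt_conv_Cons) auto
    then show ?thesis by (simp add: t_def)
  qed
  have t_last: "t (n + 1) = e" by (simp add: t_def)
  have vars_t: "vars (t j) \<subseteq> {1..n + 1}" and consts_t: "consts_of (t j) \<subseteq> A" for j
    using assms consts_of_foldr_abstr [of k s _ e] k_in s_in
    by (fastforce simp: t_def expr_over_def)+
  have t_closed: "vars (t 0) = {}"
    using assms by (auto simp: t_def expr_over_def simp del: upt_Suc)
  have eval_t: "\<exists>c\<in>A. \<forall>p\<in>P. eval_expr app p (subst_expr (n + 1) a (t j)) = Some c \<and>
      (\<forall>b\<in>A. app p c b = eval_expr app p (subst_expr (n + 1) (a(j + 1 := b)) (t (j + 1))))"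
    if "j \<le> n" "\<forall>i\<in>{1..n + 1}. a i \<in> A" for a j
    unfolding t_abs [OF that(1)]
    by (rule eval_abstr) (use that vars_t consts_t in auto)
  \<comment> \<open>The constant assignment \<open>k\<close> is a dummy with values in
    \<open>A\<close>; substitution leaves the closed \<open>t 0\<close> unchanged.\<close>
  obtain estar where estar: "estar \<in> A" "\<And>p. p \<in> P \<Longrightarrow> eval_expr app p (t 0) = Some estar"
    using eval_t [of 0 "\<lambda>_. k"] k_in by (auto simp: subst_expr_closed [OF t_closed])
  have step: "eval_expr app p (App_list (Const estar) (map (\<lambda>i. Const (a i)) [1..<j + 1]))
      = eval_expr app p (subst_expr (n + 1) a (t j))"
    if p: "p \<in> P" and a: "\<forall>i\<in>{1..n + 1}. a i \<in> A" and "j \<le> n + 1" for p a j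
    using \<open>j \<le> n + 1\<close>
  proof (induction j)
    case 0
    then show ?case
      using estar p by (simp add: App_list_def subst_expr_closed [OF t_closed])
  next
    case (Suc j)
    obtain c where "eval_expr app p (subst_expr (n + 1) a (t j)) = Some c"
      "\<forall>b\<in>A. app p c b = eval_expr app p (subst_expr (n + 1) (a(j + 1 := b)) (t (j + 1)))"
      using eval_t [OF _ a, of j] Suc.prems p by auto
    moreover have "a (j + 1) \<in> A" using a Suc.prems by auto
    \<comment> \<open>Take \<open>b = a (j + 1)\<close>: the updated assignment is then
      \<open>a\<close> itself.\<close>
    ultimately show ?case
      using Suc by (auto simp: App_list_snoc dest!: bspec [where x = "a (j + 1)"])
  qed
  show ?thesis
  proof (intro bexI [OF _ estar(1)] allI impI conjI ballI)
    fix a :: "nat \<Rightarrow> 'a"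
    assume a: "\<forall>i\<in>{1..n + 1}. a i \<in> A"
    have "closed_expr A (App_list (Const estar) (map (\<lambda>i. Const (a i)) [1..<n + 1]))"
      using a estar(1)
      unfolding closed_expr_App_list by (auto simp: closed_expr_def simp del: upt_Suc)
    \<comment> \<open>After \<open>n\<close> arguments the value is that of \<open>t n\<close>,
      still an abstraction over \<open>x_{n+1}\<close>, hence the same at every
      \<open>p\<close>.\<close>
    then show "uniform_expr A P app (App_list (Const estar) (map (\<lambda>i. Const (a i)) [1..<n + 1]))"
      using step [OF _ a, of _ n] eval_t [OF order_refl a] by (auto simp: uniform_expr_def)
    show "eval_expr app p (App_list (Const estar) (map (\<lambda>i. Const (a i)) [1..<n + 2]))
        = eval_expr app p (subst_expr (n + 1) a e)" if "p \<in> P" for p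
      using step [OF that a order_refl, unfolded t_last] by simp
  qed
qed

end

text \<open>Nonemptiness of \<open>P\<close> supplies a reference point \<open>r\<close>. The values
  of \<open>k a\<close> and \<open>s a b\<close> at \<open>r\<close> lie in \<open>A\<close> by
  closure and, by the uniformity laws, are their values at every \<open>p\<close>.\<close>

lemma (in ppca) ex_uniform_combinators: "\<exists>k s. uniform_combinators A P app k s"
proof -
  obtain k s where ks: "k \<in> A" "s \<in> A" and
    laws: "\<And>p q a b c. \<lbrakk>p \<in> P; q \<in> P; a \<in> A; b \<in> A; c \<in> A\<rbrakk> \<Longrightarrow>
      app p k a \<noteq> None \<and> app p k a = app q k a \<and>
      lift_app app p (app p k a) (Some b) = Some a \<and>
      lift_app app p (app p s a) (Some b) \<noteq> None \<and>
      app p s a \<noteq> None \<and>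
      lift_app app p (app p s a) (Some b) = lift_app app q (app q s a) (Some b) \<and>
      lift_app app p (lift_app app p (app p s a) (Some b)) (Some c)
        = lift_app app p (app p a c) (app p b c)"
    using combinators by (elim bexE) metis
  obtain r where r: "r \<in> P" using P_nonempty by blast
  have "uniform_combinators A P app k s"
  proof
    fix a assume a: "a \<in> A"
    obtain c where c: "app r k a = Some c" using laws [OF r r a a a] by auto
    have "app p k a = Some c \<and> (\<forall>b\<in>A. app p c b = Some a)" if "p \<in> P" for p
      using laws [OF that r a _ a] c a by (metis lift_app_simps(3))
    with app_closed [OF r ks(1) a c]
    show "\<exists>c\<in>A. \<forall>p\<in>P. app p k a = Some c \<and> (\<forall>b\<in>A. app p c b = Some a)" by blast
  next
    fix a b assume ab: "a \<in> A" "b \<in> A"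
    obtain f c where f: "app r s a = Some f"
      and c: "lift_app app r (app r s a) (Some b) = Some c"
      using laws [OF r r ab ab(1)] by auto
    have "c \<in> A"
      using app_closed [OF r ks(2) ab(1) f] app_closed [OF r _ ab(2)] c f by simp
    moreover have "lift_app app p (app p s a) (Some b) = Some c \<and>
        (\<forall>d\<in>A. app p c d = lift_app app p (app p a d) (app p b d))" if "p \<in> P" for p
      using laws [OF that r ab] c ab(1) by (metis lift_app_simps(3))
    ultimately show "\<exists>c\<in>A. \<forall>p\<in>P. lift_app app p (app p s a) (Some b) = Some c \<and>
        (\<forall>d\<in>A. app p c d = lift_app app p (app p a d) (app p b d))" by blast
  qed (fact ks)+
  then show ?thesis by blast
qed

theorem theorem3p12:
  fixes A :: "'a set" and P :: "'p set"
    and app :: "'p \<Rightarrow> 'a \<Rightarrow> 'a \<Rightarrow> 'a option"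
    and n :: nat and e :: "'a expr"
  assumes "ppca A P app"
    and "expr_over A (n + 1) e"
  shows "\<exists>estar\<in>A. \<forall>a :: nat \<Rightarrow> 'a. (\<forall>i\<in>{1..n + 1}. a i \<in> A) \<longrightarrow>
    uniform_expr A P app (App_list (Const estar) (map (\<lambda>i. Const (a i)) [1..<n + 1])) \<and>
    (\<forall>p\<in>P. eval_expr app p (App_list (Const estar) (map (\<lambda>i. Const (a i)) [1..<n + 2]))
          = eval_expr app p (subst_expr (n + 1) a e))"
  using ppca.ex_uniform_combinators [OF assms(1)]
    uniform_combinators.combinatory_completeness [OF _ assms(2)] by blast

end
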